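(* Let $n\ge 1$, let $\alpha_1,\dots,\alpha_n\in\mathbb{C}$, let $\lambda>0$ be real, and set $$F_\lambda(z)=\prod_{i=1}^{n}\left(z-\frac{\alpha_i}{\lambda}\right).$$ Suppose that $$\lambda\ \ge\ 6.15\,\max_{1\le i\le n}|\alpha_i| .$$ Then the Blaschke factorization $F_\lambda(z)=B(z)\cdot G_\lambda(z)$ (with respect to the unit disk) satisfies $$\|G_\lambda\|_{\mathcal D}^2\ \le\ \frac12\,\|F_\lambda\|_{\mathcal D}^2 .$$
   Context: Blaschke factorization with respect to the unit disk: for a nonzero polynomial $P$, let $B(z)=\prod_{i}\frac{z-\beta_i}{1-\overline{\beta_i}z}$, the product being over the roots $\beta_i$ of $P$, counted with multiplicity, with $|\beta_i|<1$; then $P=B\cdot G$, where the polynomial $G=P/B$ is obtained from $P$ by replacing each factor $z-\beta_i$ with $|\beta_i|<1$ by $1-\overline{\beta_i}z$. Dirichlet (semi)norm: for $f(z)=\sum_{k\ge 0}a_kz^k$, $\|f\|_{\mathcal D}^2=\sum_{k\ge 1}k|a_k|^2$. *)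

theory Defs
  imports "HOL-Computational_Algebra.Computational_Algebra"
    "HOL-Library.Extended_Nonnegative_Real"
begin

definition blaschke_product :: "complex poly \<Rightarrow> complex \<Rightarrow> complex" where
  "blaschke_product P z =
     (\<Prod>b | poly P b = 0 \<and> cmod b < 1. ((z - b) / (1 - cnj b * z)) ^ order b P)"

text \<open>
  The polynomial \<open>G = P / B\<close>: in the factorization of \<open>P\<close> into linear factors, each factor
  \<open>z - b\<close> with \<open>|b| < 1\<close> is replaced by \<open>1 - cnj b * z\<close>. Meaningful for \<open>P \<noteq> 0\<close>.
\<close>

definition blaschke_cofactor :: "complex poly \<Rightarrow> complex poly" where
  "blaschke_cofactor P =
     smult (lead_coeff P)
       (\<Prod>b | poly P b = 0. (if cmod b < 1 then [:1, - cnj b:] else [:- b, 1:]) ^ order b P)"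

lemma blaschke_factorization:
  assumes "P \<noteq> 0"
    and "\<And>b. poly P b = 0 \<Longrightarrow> cmod b < 1 \<Longrightarrow> 1 - cnj b * z \<noteq> 0"
  shows "poly P z = blaschke_product P z * poly (blaschke_cofactor P) z"
proof -
  let ?R = "{b. poly P b = 0}"
  let ?g = "\<lambda>b. if cmod b < 1 then (z - b) / (1 - cnj b * z) else 1"
  let ?h = "\<lambda>b. if cmod b < 1 then [:1, - cnj b:] else [:- b, 1:]"
  have fin: "finite ?R"
    using assms(1) by (rule poly_roots_finite)
  have B: "blaschke_product P z = (\<Prod>b\<in>?R. ?g b ^ order b P)"
    unfolding blaschke_product_def using fin by (intro prod.mono_neutral_cong_left) auto
  have "poly P z = lead_coeff P * (\<Prod>b\<in>?R. (z - b) ^ order b P)"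
    by (subst complex_poly_decompose [of P, symmetric]) (simp add: poly_prod)
  also have "(\<Prod>b\<in>?R. (z - b) ^ order b P)
      = (\<Prod>b\<in>?R. ?g b ^ order b P * poly (?h b ^ order b P) z)"
    using assms(2)
    by (intro prod.cong refl) (auto simp: power_mult_distrib [symmetric] mult.commute)
  also have "lead_coeff P * \<dots> = blaschke_product P z * poly (blaschke_cofactor P) z"
    by (simp add: B blaschke_cofactor_def poly_prod prod.distrib)
  finally show ?thesis .
qed

text \<open>
  The square of the Dirichlet seminorm of a power series. It takes values in
  \<^typ>\<open>ennreal\<close> because the series diverges for some \<open>f\<close>; it is finite for polynomials.
\<close>

definition dirichlet_seminorm_sq :: "complex fps \<Rightarrow> ennreal" where
  "dirichlet_seminorm_sq f = (\<Sum>k. ennreal (real k * (cmod (fps_nth f k))\<^sup>2))"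

lemma dirichlet_seminorm_sq_poly:
  "dirichlet_seminorm_sq (fps_of_poly p)
     = ennreal (\<Sum>k=1..degree p. real k * (cmod (coeff p k))\<^sup>2)"
proof -
  have "dirichlet_seminorm_sq (fps_of_poly p)
      = (\<Sum>k=1..degree p. ennreal (real k * (cmod (coeff p k))\<^sup>2))"
    unfolding dirichlet_seminorm_sq_def fps_of_poly_nth
  proof (rule suminf_finite)
    fix k assume "k \<notin> {1..degree p}"
    hence "k = 0 \<or> degree p < k" by auto
    thus "ennreal (real k * (cmod (coeff p k))\<^sup>2) = 0"
      by (auto simp: coeff_eq_0)
  qed simp
  thus ?thesis by (simp add: sum_ennreal)
qed

end

theory Submission
  imports Defs
begin

text \<open>
  Write \<open>b\<^sub>i = \<alpha>\<^sub>i / \<lambda>\<close> and suppose all \<open>|b\<^sub>i| \<le> r < 1\<close>. Then all roots of \<open>F\<close> lie in the disk, so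
  the cofactor is \<open>G = (\<Prod>i. 1 - cnj b\<^sub>i z)\<close>, and its coefficients are, up to conjugation, those
  of \<open>F\<close> in reverse order. With \<open>N = (\<Sum>k. |g\<^sub>k|\<^sup>2)\<close> and \<open>D = (\<Sum>k. k |g\<^sub>k|\<^sup>2)\<close> the two seminorms are
  therefore \<open>\<parallel>G\<parallel>\<^sup>2 = D\<close> and \<open>\<parallel>F\<parallel>\<^sup>2 = n N - D\<close>, and everything rests on the bound
  \<open>(1 + r) D \<le> r n N\<close>, which says \<open>\<parallel>G\<parallel>\<^sup>2 \<le> r \<parallel>F\<parallel>\<^sup>2\<close>. The hypothesis on
  \<open>\<lambda>\<close> gives \<open>|b\<^sub>i| \<le> 1 / 2\<close>, and the theorem is the case \<open>r = 1 / 2\<close>.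

  Analytically the bound holds because \<open>D\<close> is the mean of \<open>|G|\<^sup>2 Re (z G' / G)\<close> over the unit
  circle, and \<open>z G' / G\<close> is a sum of \<open>n\<close> terms \<open>- w / (1 - w)\<close> with \<open>|w| \<le> r\<close>, each of real part
  at most \<open>r / (1 + r)\<close>. The proof below replaces the integral by the inner product of
  coefficient sequences. One summand of \<open>z G'\<close> is \<open>- c z H\<close> with \<open>G = (1 - c z) H\<close>, and its inner
  product with \<open>G\<close> is estimated coefficient by coefficient, with an error that telescopes
  (\<open>linear_factor_inner_le\<close>); the product rule adds up the \<open>n\<close> estimates
  (\<open>weighted_coeff_sum_le\<close>).
\<close>

section \<open>The logarithmic derivative bound on coefficients\<close>

text \<open>
  Here \<open>a\<close> and \<open>b\<close> stand for consecutive coefficients of \<open>H\<close>, so \<open>a - c b\<close> is one of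
  \<open>(1 - c z) H\<close>. Expansion of \<open>r |a - c b|\<^sup>2\<close> minus the left-hand side gives
  \<open>r |a|\<^sup>2 + (1 - r) Re (cnj a c b) - |c b|\<^sup>2\<close>. When \<open>|c b| \<le> r |b|\<close> and
  \<open>|a| |b| \<le> (|a|\<^sup>2 + |b|\<^sup>2) / 2\<close> bound the last two terms from below, \<open>|a|\<^sup>2\<close> and \<open>|b|\<^sup>2\<close> are left
  with opposite coefficients, which is why the error telescopes.
\<close>

lemma linear_factor_pointwise:
  fixes a b c :: complex
  assumes "cmod c \<le> r" "r \<le> 1"
  shows "(1 + r) * Re (cnj (a - c * b) * (- c * b))
           \<le> r * (cmod (a - c * b))\<^sup>2 - r * (1 + r) / 2 * ((cmod a)\<^sup>2 - (cmod b)\<^sup>2)"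
proof -
  define v where "v = c * b"
  define x where "x = Re (cnj a * v)"
  have r: "0 \<le> r"
    using assms(1) norm_ge_zero order_trans by blast
  have v: "cmod v \<le> r * cmod b"
    unfolding v_def norm_mult using assms(1) by (rule mult_right_mono) simp
  have vv: "(cmod v)\<^sup>2 \<le> r\<^sup>2 * (cmod b)\<^sup>2"
    using power_mono[OF v, of 2] by (simp add: power_mult_distrib)
  have "- x \<le> cmod (cnj a * v)"
    unfolding x_def using abs_Re_le_cmod[of "cnj a * v"] by linarith
  also have "\<dots> \<le> r * (cmod a * cmod b)"
    using mult_left_mono[OF v, of "cmod a"] by (simp add: norm_mult mult_ac)
  also have "\<dots> \<le> r * (((cmod a)\<^sup>2 + (cmod b)\<^sup>2) / 2)"
    using r sum_squares_bound[of "cmod a" "cmod b"] by (intro mult_left_mono) auto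
  finally have "(1 - r) * (- x) \<le> (1 - r) * (r * (((cmod a)\<^sup>2 + (cmod b)\<^sup>2) / 2))"
    using assms(2) by (intro mult_left_mono) auto
  hence "0 \<le> r * (cmod a)\<^sup>2 + (1 - r) * x - (cmod v)\<^sup>2
               - r * (1 + r) / 2 * ((cmod a)\<^sup>2 - (cmod b)\<^sup>2)"
    using vv by (simp add: field_simps power2_eq_square)
  also have "r * (cmod a)\<^sup>2 + (1 - r) * x - (cmod v)\<^sup>2
      = r * (cmod (a - v))\<^sup>2 - (1 + r) * Re (cnj (a - v) * (- v))"
    unfolding x_def cmod_power2 by (simp add: power2_eq_square algebra_simps)
  finally show ?thesis
    by (simp add: v_def)
qed

text \<open>
  This is \<open>Re (- w / (1 - w)) \<le> r / (1 + r)\<close> for \<open>w = c z\<close>, multiplied by \<open>|G|\<^sup>2\<close> and averaged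
  over the circle.
\<close>

lemma linear_factor_inner_le:
  fixes c :: complex and H :: "complex poly"
  assumes "cmod c \<le> r" "r \<le> 1" and G: "G = [:1, - c:] * H"
  shows "(1 + r) * (\<Sum>k\<le>N. Re (cnj (coeff G k) * coeff ([:0, - c:] * H) k))
           \<le> r * (\<Sum>k\<le>N. (cmod (coeff G k))\<^sup>2)"
proof -
  define h where "h k = coeff (pCons 0 H) k" for k
  have r: "0 \<le> r"
    using assms(1) norm_ge_zero order_trans by blast
  have step: "(1 + r) * Re (cnj (coeff G k) * coeff ([:0, - c:] * H) k)
      \<le> r * (cmod (coeff G k))\<^sup>2 - r * (1 + r) / 2 * ((cmod (h (Suc k)))\<^sup>2 - (cmod (h k))\<^sup>2)" for k
  proof -
    have "coeff G k = h (Suc k) - c * h k" "coeff ([:0, - c:] * H) k = - c * h k"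
      by (auto simp: G h_def coeff_pCons split: nat.split)
    thus ?thesis
      using linear_factor_pointwise[OF assms(1,2), of "h (Suc k)" "h k"] by simp
  qed
  have "(1 + r) * (\<Sum>k\<le>N. Re (cnj (coeff G k) * coeff ([:0, - c:] * H) k))
      \<le> (\<Sum>k\<le>N. r * (cmod (coeff G k))\<^sup>2
             - r * (1 + r) / 2 * ((cmod (h (Suc k)))\<^sup>2 - (cmod (h k))\<^sup>2))"
    unfolding sum_distrib_left by (intro sum_mono step)
  also have "\<dots> = r * (\<Sum>k\<le>N. (cmod (coeff G k))\<^sup>2)
      - r * (1 + r) / 2 * (\<Sum>k\<le>N. (cmod (h (Suc k)))\<^sup>2 - (cmod (h k))\<^sup>2)"
    unfolding sum_subtractf[of "\<lambda>k. r * _ k"] sum_distrib_left ..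
  also have "(\<Sum>k\<le>N. (cmod (h (Suc k)))\<^sup>2 - (cmod (h k))\<^sup>2) = (cmod (h (Suc N)))\<^sup>2 - (cmod (h 0))\<^sup>2"
    using sum_lessThan_telescope[of "\<lambda>k. (cmod (h k))\<^sup>2" "Suc N"] by (simp only: lessThan_Suc_atMost)
  also have "h 0 = 0"
    by (simp add: h_def)
  also have "r * (\<Sum>k\<le>N. (cmod (coeff G k))\<^sup>2) - r * (1 + r) / 2 * ((cmod (h (Suc N)))\<^sup>2 - (cmod 0)\<^sup>2)
      \<le> r * (\<Sum>k\<le>N. (cmod (coeff G k))\<^sup>2)"
    using r by simp
  finally show ?thesis .
qed

text \<open>
  The weight \<open>k\<close> turns \<open>G\<close> into \<open>z G'\<close>, and the product rule splits \<open>z G'\<close> into one term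
  \<open>- c\<^sub>i z H\<^sub>i\<close> for each factor, to which the previous lemma applies.
\<close>

lemma weighted_coeff_sum_le:
  fixes c :: "'a \<Rightarrow> complex"
  assumes "finite A" "\<And>i. i \<in> A \<Longrightarrow> cmod (c i) \<le> r" "r \<le> 1"
    and G: "G = (\<Prod>i\<in>A. [:1, - c i:])"
  shows "(1 + r) * (\<Sum>k\<le>N. real k * (cmod (coeff G k))\<^sup>2)
           \<le> r * real (card A) * (\<Sum>k\<le>N. (cmod (coeff G k))\<^sup>2)"
proof -
  define H where "H i = (\<Prod>j\<in>A - {i}. [:1, - c j:])" for i
  have "pCons 0 (pderiv G) = [:0, 1:] * pderiv G"
    by simp
  also have "\<dots> = (\<Sum>i\<in>A. [:0, - c i:] * H i)"
    by (simp add: G H_def pderiv_prod pderiv_pCons sum_distrib_left mult_ac)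
  finally have zG': "pCons 0 (pderiv G) = (\<Sum>i\<in>A. [:0, - c i:] * H i)" .
  have summand: "real k * (cmod (coeff G k))\<^sup>2
      = (\<Sum>i\<in>A. Re (cnj (coeff G k) * coeff ([:0, - c i:] * H i) k))" for k
  proof -
    have "(\<Sum>i\<in>A. Re (cnj (coeff G k) * coeff ([:0, - c i:] * H i) k))
        = Re (cnj (coeff G k) * coeff (pCons 0 (pderiv G)) k)"
      by (simp only: zG' coeff_sum sum_distrib_left Re_sum)
    also have "coeff (pCons 0 (pderiv G)) k = of_nat k * coeff G k"
      by (simp add: coeff_pCons coeff_pderiv split: nat.split)
    also have "Re (cnj (coeff G k) * (of_nat k * coeff G k)) = real k * (cmod (coeff G k))\<^sup>2"
      unfolding cmod_power2 by (simp add: power2_eq_square algebra_simps)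
    finally show ?thesis ..
  qed
  have "(1 + r) * (\<Sum>k\<le>N. real k * (cmod (coeff G k))\<^sup>2)
      = (\<Sum>i\<in>A. (1 + r) * (\<Sum>k\<le>N. Re (cnj (coeff G k) * coeff ([:0, - c i:] * H i) k)))"
    unfolding summand by (subst sum.swap) (simp only: sum_distrib_left)
  also have "\<dots> \<le> (\<Sum>i\<in>A. r * (\<Sum>k\<le>N. (cmod (coeff G k))\<^sup>2))"
  proof (intro sum_mono linear_factor_inner_le assms(2,3))
    fix i assume "i \<in> A"
    thus "G = [:1, - c i:] * H i"
      unfolding G H_def using assms(1) by (rule prod.remove[rotated])
  qed
  finally show ?thesis
    by (simp add: mult_ac)
qed

section \<open>The Blaschke cofactor of a product of linear factors\<close>

lemma order_prod_linear_factors: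
  fixes b :: "'a \<Rightarrow> complex"
  assumes "finite A"
  shows "order x (\<Prod>i\<in>A. [:- b i, 1:]) = card {i\<in>A. b i = x}"
  using assms
proof (induction rule: finite_induct)
  case (insert j A)
  have "order x ([:- b j, 1:] * (\<Prod>i\<in>A. [:- b i, 1:]))
      = order x [:- b j, 1:] + card {i\<in>A. b i = x}"
  proof -
    have "[:- b j, 1:] * (\<Prod>i\<in>A. [:- b i, 1:]) \<noteq> 0"
      using insert.hyps(1) by (simp only: mult_eq_0_iff prod_zero_iff) simp
    from order_mult[OF this, of x] show ?thesis
      unfolding insert.IH .
  qed
  moreover have "{i \<in> insert j A. b i = x}
      = (if b j = x then insert j {i\<in>A. b i = x} else {i\<in>A. b i = x})"
    by auto
  moreover have "order x [:- b j, 1:] = (if b j = x then 1 else 0)"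
    using order_power_n_n[of x 1] by (auto simp: order_root intro: order_0I)
  ultimately show ?case
    using insert by simp
qed simp

lemma blaschke_cofactor_prod:
  fixes b :: "'a \<Rightarrow> complex"
  assumes "finite A" "\<And>i. i \<in> A \<Longrightarrow> cmod (b i) < 1"
  shows "blaschke_cofactor (\<Prod>i\<in>A. [:- b i, 1:]) = (\<Prod>i\<in>A. [:1, - cnj (b i):])"
proof -
  let ?F = "\<Prod>i\<in>A. [:- b i, 1:]"
  have roots: "{x. poly ?F x = 0} = b ` A"
    using assms(1) by (auto simp: poly_prod)
  have "blaschke_cofactor ?F
      = (\<Prod>x\<in>b ` A. (if cmod x < 1 then [:1, - cnj x:] else [:- x, 1:]) ^ order x ?F)"
    unfolding blaschke_cofactor_def roots by (simp add: lead_coeff_prod)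
  also have "\<dots> = (\<Prod>x\<in>b ` A. \<Prod>i | i \<in> A \<and> b i = x. [:1, - cnj (b i):])"
    using assms by (intro prod.cong refl) (auto simp: order_prod_linear_factors)
  also have "\<dots> = (\<Prod>i\<in>A. [:1, - cnj (b i):])"
    using assms(1) by (rule prod.image_gen[symmetric])
  finally show ?thesis .
qed

lemma coeff_prod_cnj:
  "coeff (\<Prod>i\<in>A. [:1, - cnj (b i):]) k = cnj (coeff (\<Prod>i\<in>A. [:1, - b i:]) k)"
proof (induction A arbitrary: k rule: infinite_finite_induct)
  case (insert j A)
  thus ?case
    by (auto simp: coeff_pCons split: nat.split)
qed auto

text \<open>
  Reversal of the coefficients is multiplicative and turns \<open>z - b\<close> into \<open>1 - b z\<close>; conjugation of
  the coefficients then gives \<open>1 - cnj b z\<close> and leaves their moduli unchanged. A zero \<open>b = 0\<close> loses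
  a degree, so the reversal has to be taken at \<open>card A\<close>, not at the degree of the cofactor.
\<close>

lemma cmod_coeff_blaschke_cofactor_prod:
  fixes b :: "'a \<Rightarrow> complex"
  assumes "finite A" "\<And>i. i \<in> A \<Longrightarrow> cmod (b i) < 1" "k \<le> card A"
    and F: "F = (\<Prod>i\<in>A. [:- b i, 1:])"
  shows "cmod (coeff (blaschke_cofactor F) k) = cmod (coeff F (card A - k))"
proof -
  have "reflect_poly F = (\<Prod>i\<in>A. [:1, - b i:])"
    unfolding F reflect_poly_prod by (intro prod.cong refl) (auto simp: reflect_poly_def)
  moreover have "degree F = card A"
    unfolding F by (subst degree_prod_eq_sum_degree) auto
  ultimately have "coeff (\<Prod>i\<in>A. [:1, - b i:]) k = coeff F (card A - k)"
    using assms(3) coeff_reflect_poly[of F k] by auto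
  thus ?thesis
    by (simp add: F blaschke_cofactor_prod assms(1,2) coeff_prod_cnj)
qed

section \<open>Comparison of the two seminorms\<close>

lemma dirichlet_seminorm_sq_poly_atMost:
  assumes "degree p \<le> N"
  shows "dirichlet_seminorm_sq (fps_of_poly p)
           = ennreal (\<Sum>k\<le>N. real k * (cmod (coeff p k))\<^sup>2)"
proof -
  have "(\<Sum>k=1..degree p. real k * (cmod (coeff p k))\<^sup>2) = (\<Sum>k\<le>N. real k * (cmod (coeff p k))\<^sup>2)"
    using assms by (intro sum.mono_neutral_left) (auto simp: not_le coeff_eq_0 Suc_le_eq)
  thus ?thesis
    by (simp add: dirichlet_seminorm_sq_poly)
qed

text \<open>
  In the notation of the introduction, reversal gives \<open>\<parallel>F\<parallel>\<^sup>2 = (\<Sum>k. (n - k) |g\<^sub>k|\<^sup>2) = n N - D\<close>, so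
  \<open>D \<le> r (n N - D)\<close> is a rearrangement of \<open>(1 + r) D \<le> r n N\<close>.
\<close>

lemma dirichlet_blaschke_cofactor_le:
  fixes b :: "'a \<Rightarrow> complex"
  assumes "finite A" "\<And>i. i \<in> A \<Longrightarrow> cmod (b i) \<le> r" "0 \<le> r" "r < 1"
    and F: "F = (\<Prod>i\<in>A. [:- b i, 1:])"
  shows "dirichlet_seminorm_sq (fps_of_poly (blaschke_cofactor F))
           \<le> ennreal r * dirichlet_seminorm_sq (fps_of_poly F)"
proof -
  define n where "n = card A"
  define G where "G = blaschke_cofactor F"
  define D where "D = (\<Sum>k\<le>n. real k * (cmod (coeff G k))\<^sup>2)"
  have lt: "cmod (b i) < 1" if "i \<in> A" for i
    using assms(2)[OF that] assms(4) by linarith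
  have G: "G = (\<Prod>i\<in>A. [:1, - cnj (b i):])"
    unfolding G_def F using assms(1) lt by (rule blaschke_cofactor_prod)
  have degG: "degree G \<le> n"
  proof -
    have "degree G \<le> (\<Sum>i\<in>A. degree [:1, - cnj (b i):])"
      unfolding G using degree_prod_sum_le[OF assms(1), of "\<lambda>i. [:1, - cnj (b i):]"]
      by (simp only: o_def)
    also have "\<dots> \<le> (\<Sum>i\<in>A. 1)"
      by (intro sum_mono) simp
    finally show ?thesis
      by (simp add: n_def)
  qed
  have degF: "degree F \<le> n"
    unfolding F n_def by (subst degree_prod_eq_sum_degree) auto
  have "(\<Sum>k\<le>n. real k * (cmod (coeff F k))\<^sup>2) = (\<Sum>k\<le>n. real (n - k) * (cmod (coeff F (n - k)))\<^sup>2)"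
    by (rule sum.reindex_bij_witness[of _ "\<lambda>k. n - k" "\<lambda>k. n - k"]) auto
  also have "\<dots> = (\<Sum>k\<le>n. real n * (cmod (coeff G k))\<^sup>2 - real k * (cmod (coeff G k))\<^sup>2)"
    using cmod_coeff_blaschke_cofactor_prod[OF assms(1) lt _ F]
    by (intro sum.cong refl) (simp add: G_def n_def of_nat_diff left_diff_distrib)
  also have "\<dots> = real n * (\<Sum>k\<le>n. (cmod (coeff G k))\<^sup>2) - D"
    by (simp add: D_def sum_subtractf sum_distrib_left)
  finally have DF: "(\<Sum>k\<le>n. real k * (cmod (coeff F k))\<^sup>2)
      = real n * (\<Sum>k\<le>n. (cmod (coeff G k))\<^sup>2) - D" .
  have "(1 + r) * D \<le> r * real n * (\<Sum>k\<le>n. (cmod (coeff G k))\<^sup>2)"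
    unfolding D_def n_def using assms(1,2,4) G by (intro weighted_coeff_sum_le) auto
  hence "D \<le> r * (\<Sum>k\<le>n. real k * (cmod (coeff F k))\<^sup>2)"
    unfolding DF by (simp add: algebra_simps)
  hence "ennreal D \<le> ennreal r * ennreal (\<Sum>k\<le>n. real k * (cmod (coeff F k))\<^sup>2)"
    using assms(3) by (subst ennreal_mult[symmetric]) (auto intro: sum_nonneg ennreal_leI)
  thus ?thesis
    using degF degG by (simp add: dirichlet_seminorm_sq_poly_atMost D_def G_def)
qed

theorem theorem2p1:
  fixes n :: nat and \<alpha> :: "nat \<Rightarrow> complex" and lam :: real and F :: "complex poly"
  assumes "n \<ge> 1" and "lam > 0"
    and "F = (\<Prod>i=1..n. [:- (\<alpha> i / complex_of_real lam), 1:])"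
    and "lam \<ge> 6.15 * Max ((\<lambda>i. cmod (\<alpha> i)) ` {1..n})"
  shows "dirichlet_seminorm_sq (fps_of_poly (blaschke_cofactor F))
           \<le> 1 / 2 * dirichlet_seminorm_sq (fps_of_poly F)"
proof -
  have "cmod (\<alpha> i / complex_of_real lam) \<le> 1 / 2" if "i \<in> {1..n}" for i
  proof -
    have "cmod (\<alpha> i) \<le> Max ((\<lambda>i. cmod (\<alpha> i)) ` {1..n})"
      using that by (intro Max_ge) auto
    hence "6.15 * cmod (\<alpha> i) \<le> 6.15 * Max ((\<lambda>i. cmod (\<alpha> i)) ` {1..n})"
      by (rule mult_left_mono) simp
    also have "\<dots> \<le> lam"
      by (rule assms(4))
    finally have "123 * cmod (\<alpha> i) \<le> 20 * lam"
      by simp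
    hence "2 * cmod (\<alpha> i) \<le> lam"
      using norm_ge_zero[of "\<alpha> i"] by linarith
    thus ?thesis
      using assms(2) by (simp add: norm_divide field_simps)
  qed
  hence "dirichlet_seminorm_sq (fps_of_poly (blaschke_cofactor F))
      \<le> ennreal (1 / 2) * dirichlet_seminorm_sq (fps_of_poly F)"
    using assms(3) by (intro dirichlet_blaschke_cofactor_le[of "{1..n}"]) auto
  also have "ennreal (1 / 2) = 1 / 2"
    by (subst divide_ennreal[symmetric]) auto
  finally show ?thesis .
qed

end
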